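(* Let $\mathbb{D}=\{w\in\mathbb{C}: |w|<1\}$ and, for a real parameter $c$, let $$\varphi_c(w)=\frac{1}{w}-\frac{c}{1-cw}-c^2w .$$ Put $c^*=\frac{\sqrt5-1}{2}$ and $c_1=\frac{3-\sqrt5}{2}$. Then $\varphi_c$ is univalent on $\mathbb{D}$ (as a map into the Riemann sphere, with $\varphi_c(0)=\infty$) for $0\le c<c^*$. Furthermore, the boundary curve $\varphi_c(\partial\mathbb{D})$ is convex for $0\le c<c_1$, and, among the values $0\le c<c^*$, only for these.
   Context: Univalent means injective and meromorphic on $\mathbb{D}$. The image $\Omega=\varphi_c(\mathbb{D})$ is the exterior (complement in the Riemann sphere) of a droplet, and the boundary curve is the closed curve $\theta\mapsto\varphi_c(e^{i\theta})$. Convexity of this smooth closed curve is understood through its signed curvature: the curve is called convex if its signed curvature has constant sign, i.e. is everywhere nonzero and of the same sign along the curve. *)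

theory Defs
  imports "HOL-Complex_Analysis.Complex_Analysis"
begin

text \<open>
  The Riemann sphere as a point set is modelled by \<^typ>\<open>complex option\<close>, with \<^term>\<open>None\<close>
  as the point at infinity; this is the carrier of
  \<^term>\<open>Alexandroff_compactification (euclidean :: complex topology)\<close>.
\<close>

type_synonym riemann_sphere = "complex option"

abbreviation sphere_infinity :: riemann_sphere where
  "sphere_infinity \<equiv> None"

text \<open>
  The map to the sphere induced by a meromorphic function. The library's notion of
  meromorphic function ignores the values at isolated singularities, so poles are sent to
  infinity and removable singularities are filled in; at points where \<open>f\<close> is analytic the
  value is \<open>f z\<close>.
\<close>

definition to_sphere :: "(complex \<Rightarrow> complex) \<Rightarrow> complex \<Rightarrow> riemann_sphere" where
  "to_sphere f z = (if is_pole f z then sphere_infinity else Some (remove_sings f z))"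

definition univalent_on :: "(complex \<Rightarrow> complex) \<Rightarrow> complex set \<Rightarrow> bool" where
  "univalent_on f A \<longleftrightarrow> f meromorphic_on A \<and> inj_on (to_sphere f) A"

text \<open>
  Signed curvature of a twice differentiable plane curve,
  \<open>(x' y'' - y' x'') / (x'^2 + y'^2) powr (3/2)\<close> in complex notation. Because division by
  zero yields zero, the curvature vanishes by convention wherever the velocity does.
\<close>

definition signed_curvature :: "(real \<Rightarrow> complex) \<Rightarrow> real \<Rightarrow> real" where
  "signed_curvature \<gamma> t =
     (let v = vector_derivative \<gamma> (at t);
          a = vector_derivative (\<lambda>s. vector_derivative \<gamma> (at s)) (at t)
      in (Re v * Im a - Im v * Re a) / norm v ^ 3)"

text \<open>
  A smooth closed curve is given by a periodic parametrisation over the whole real line.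
\<close>

definition convex_curve :: "(real \<Rightarrow> complex) \<Rightarrow> bool" where
  "convex_curve \<gamma> \<longleftrightarrow>
     (\<forall>t. signed_curvature \<gamma> t > 0) \<or> (\<forall>t. signed_curvature \<gamma> t < 0)"

definition phi :: "real \<Rightarrow> complex \<Rightarrow> complex" where
  "phi c w = 1 / w - of_real c / (1 - of_real c * w) - (of_real c)\<^sup>2 * w"

definition boundary_curve :: "real \<Rightarrow> real \<Rightarrow> complex" where
  "boundary_curve c \<theta> = phi c (exp (\<i> * of_real \<theta>))"

definition c_star :: real where
  "c_star = (sqrt 5 - 1) / 2"

definition c_one :: real where
  "c_one = (3 - sqrt 5) / 2"

end

theory Submission
  imports Defs
begin

text \<open>
  \<open>phi c w = phi c z\<close> with \<open>w \<noteq> z\<close> means that the polynomial \<open>collision c w z\<close> vanishes. As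
  \<open>c\<close> grows from \<open>0\<close>, where this polynomial is constantly \<open>1\<close>, a zero can enter the closed
  bidisc only through the torus \<open>norm w = norm z = 1\<close>. There conjugation yields a second
  equation, and eliminating \<open>w + z\<close> leaves either \<open>w * z = 1\<close>, which is impossible, or
  \<open>norm (1 + c\<^sup>2 * (w * z)) = c\<close>, which forces \<open>1 - c\<^sup>2 \<le> c\<close>, that is, \<open>c_star \<le> c\<close>.

  The sign of the curvature at \<open>w = exp (\<i> * \<theta>)\<close> is opposite to that of a cubic polynomial in
  \<open>2 * (1 - cos \<theta>)\<close> whose value at \<open>\<theta> = 0\<close> changes sign exactly at \<open>c_one\<close>.
\<close>

section \<open>The two threshold values\<close>

lemma c_star_less_one: "c_star < 1"
proof -
  have "sqrt 5 < 3"
    by (rule real_less_lsqrt) auto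
  then show ?thesis
    by (simp add: c_star_def)
qed

text \<open>\<open>c_star\<close> is the positive root of \<open>c\<^sup>2 + c - 1\<close>; the
  square is completed.\<close>

lemma c_star_bound:
  assumes "0 \<le> c" "c < c_star"
  shows "c < 1 - c\<^sup>2"
proof -
  have "(2 * c + 1)\<^sup>2 < (sqrt 5)\<^sup>2"
    using assms by (intro power_strict_mono) (auto simp: c_star_def)
  then show ?thesis
    by (simp add: power2_eq_square algebra_simps)
qed

text \<open>\<open>c_one\<close> is the smaller root of \<open>1 + c\<^sup>2 - 3 * c\<close>, and
  the other root exceeds 1.\<close>

lemma c_one_iff:
  assumes "0 \<le> c" "c < 1"
  shows "c < c_one \<longleftrightarrow> 0 < 1 + c\<^sup>2 - 3 * c"
proof -
  have "c < c_one \<longleftrightarrow> sqrt 5 < sqrt ((3 - 2 * c)\<^sup>2)"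
    using assms by (auto simp: c_one_def)
  also have "\<dots> \<longleftrightarrow> 5 < (3 - 2 * c)\<^sup>2"
    by (rule real_sqrt_less_iff)
  also have "(3 - 2 * c)\<^sup>2 = 5 + 4 * (1 + c\<^sup>2 - 3 * c)"
    by (simp add: power2_eq_square algebra_simps)
  finally show ?thesis
    by auto
qed

section \<open>Quadratics without zeros in the open disc\<close>

lemma norm_one_minus_ge:
  fixes r w :: "'a::real_normed_div_algebra"
  assumes "norm r \<le> 1"
  shows "1 - norm w \<le> norm (1 - r * w)"
proof -
  have "norm (r * w) \<le> norm w"
    using assms by (simp add: norm_mult mult_left_le_one_le)
  then show ?thesis
    using norm_triangle_ineq2[of 1 "r * w"] by simp
qed

text \<open>The quadratic factors through the reciprocals of its roots (0 if \<open>d = 0\<close>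
  lowers the degree), which have norm at most 1. The bound depends on the coefficients only through
  \<open>a\<close>, so it survives limits: a quantitative form of Hurwitz's theorem.\<close>

lemma norm_quadratic_ge:
  fixes a b d w :: complex
  assumes nz: "\<And>v. norm v < 1 \<Longrightarrow> a + b * v + d * v\<^sup>2 \<noteq> 0"
    and w: "norm w \<le> 1"
  shows "norm a * (1 - norm w)\<^sup>2 \<le> norm (a + b * w + d * w\<^sup>2)"
proof -
  define D where "D = csqrt (b\<^sup>2 - 4 * a * d)"
  define r\<^sub>1 where "r\<^sub>1 = (- b + D) / (2 * a)"
  define r\<^sub>2 where "r\<^sub>2 = (- b - D) / (2 * a)"
  have a: "a \<noteq> 0"
    using nz[of 0] by simp
  have b_eq: "b = - a * (r\<^sub>1 + r\<^sub>2)"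
    using a by (simp add: r\<^sub>1_def r\<^sub>2_def field_simps)
  have "a * (r\<^sub>1 * r\<^sub>2) = (b\<^sup>2 - D\<^sup>2) / (4 * a)"
    using a by (simp add: r\<^sub>1_def r\<^sub>2_def field_simps power2_eq_square)
  then have d_eq: "d = a * (r\<^sub>1 * r\<^sub>2)"
    using a by (simp add: D_def)
  have factor: "a + b * v + d * v\<^sup>2 = a * ((1 - r\<^sub>1 * v) * (1 - r\<^sub>2 * v))" for v
    unfolding b_eq d_eq by (simp add: algebra_simps power2_eq_square)
  have root_le: "norm r \<le> 1" if "r = r\<^sub>1 \<or> r = r\<^sub>2" for r
  proof (rule ccontr)
    assume "\<not> norm r \<le> 1"
    then have "norm (1 / r) < 1" "r \<noteq> 0"
      by (auto simp: norm_divide divide_simps)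
    moreover have "a + b * (1 / r) + d * (1 / r)\<^sup>2 = 0"
      unfolding factor using that \<open>r \<noteq> 0\<close> by auto
    ultimately show False
      using nz by blast
  qed
  have "(1 - norm w) * (1 - norm w) \<le> norm (1 - r\<^sub>1 * w) * norm (1 - r\<^sub>2 * w)"
    using w by (intro mult_mono norm_one_minus_ge root_le) auto
  then show ?thesis
    unfolding factor by (simp add: norm_mult power2_eq_square mult_left_mono)
qed

section \<open>Zeros of the collision polynomial\<close>

definition collision :: "real \<Rightarrow> complex \<Rightarrow> complex \<Rightarrow> complex" where
  "collision c w z =
     (1 - of_real c * w) * (1 - of_real c * z) * (1 + (of_real c)\<^sup>2 * (w * z)) + (of_real c)\<^sup>2 * (w * z)"

lemma collision_commute: "collision c w z = collision c z w"
  by (simp add: collision_def mult_ac)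

lemma phi_diff:
  assumes "w \<noteq> 0" "z \<noteq> 0" "1 - of_real c * w \<noteq> 0" "1 - of_real c * z \<noteq> 0"
  shows "phi c w - phi c z =
    (z - w) * collision c w z / (w * z * (1 - of_real c * w) * (1 - of_real c * z))"
  using assms unfolding phi_def collision_def
  by (simp add: divide_simps) (simp add: algebra_simps power2_eq_square)

lemma collision_nonzero_torus:
  assumes c: "0 \<le> c" "c < c_star" and w: "norm w = 1" and z: "norm z = 1"
  shows "collision c w z \<noteq> 0"
proof
  assume zero: "collision c w z = 0"
  define k where "k = c\<^sup>2"
  define p where "p = w * z"
  have k: "c < 1 - k" "0 \<le> k"
    using c_star_bound[OF c] by (auto simp: k_def)
  have p: "norm p = 1"
    by (simp add: p_def norm_mult w z)
  have ww: "w * cnj w = 1" and zz: "z * cnj z = 1" and pp: "p * cnj p = 1"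
    using w z p by (simp_all add: complex_norm_square[symmetric])
  have E1: "(1 - c * w) * (1 - c * z) * (1 + k * p) + k * p = 0"
    using zero by (simp add: collision_def k_def p_def)
  have "cnj ((1 - c * w) * (1 - c * z) * (1 + k * p) + k * p) = 0"
    unfolding E1 by simp
  then have "(1 - c * cnj w) * (1 - c * cnj z) * (1 + k * cnj p) + k * cnj p = 0"
    by simp
  \<comment> \<open>On the torus conjugation is inversion, so the factor \<open>w * z * p\<close>
    makes the conjugated equation polynomial in \<open>w\<close> and \<open>z\<close>.\<close>
  then have "0 = w * z * p * ((1 - c * cnj w) * (1 - c * cnj z) * (1 + k * cnj p) + k * cnj p)"
    by simp
  also have "\<dots> = (w - c * (w * cnj w)) * (z - c * (z * cnj z)) * (p + k * (p * cnj p))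
      + k * p * (p * cnj p)"
    by (simp add: algebra_simps p_def)
  finally have E2: "(w - c) * (z - c) * (p + k) + k * p = 0"
    by (simp add: ww zz pp)
  \<comment> \<open>Both equations involve \<open>w\<close> and \<open>z\<close> only through
    \<open>p\<close> and \<open>w + z\<close>; this combination cancels
    \<open>w + z\<close>.\<close>
  have "(1 - k) * (1 - p) * ((1 + k * p) * (p + k) - k * p) =
      ((1 - c * w) * (1 - c * z) * (1 + k * p) + k * p) * (p + k)
      - ((w - c) * (z - c) * (p + k) + k * p) * (1 + k * p)"
    by (simp add: k_def p_def algebra_simps power2_eq_square)
  also have "\<dots> = 0"
    unfolding E1 E2 by simp
  finally have "of_real (1 - k) = (0::complex) \<or> 1 - p = 0 \<or> (1 + k * p) * (p + k) - k * p = 0"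
    by (simp only: mult_eq_0_iff disj_assoc)
  moreover have "of_real (1 - k) \<noteq> (0::complex)"
    using k c by (simp only: of_real_eq_0_iff)
  ultimately consider "p = 1" | "(1 + k * p) * (p + k) = k * p"
    by (metis eq_iff_diff_eq_0)
  then show False
  proof cases
    case 1
    \<comment> \<open>Now the equation is a vanishing sum of nonnegative reals, which would need
      both \<open>c = 0\<close> and \<open>1 - c * w = 0\<close>.\<close>
    then have "z = cnj w"
      using ww by (metis p_def mult.assoc mult.commute mult.right_neutral zz)
    then have "(1 - c * w) * (1 - c * z) = of_real ((norm (1 - c * w))\<^sup>2)"
      by (simp only: complex_norm_square) simp
    with E1 1 have "of_real ((norm (1 - c * w))\<^sup>2 * (1 + k) + k) = (0::complex)"
      by simp
    then have "(norm (1 - c * w))\<^sup>2 * (1 + k) + k = 0"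
      by (simp only: of_real_eq_0_iff)
    then have "k = 0" "norm (1 - c * w) = 0"
      using k by (auto simp: add_nonneg_eq_0_iff)
    then show False
      by (simp add: k_def)
  next
    case 2
    \<comment> \<open>The two factors on the left of the case equation have equal norm, so its
      square is the norm of the right side, \<open>c\<^sup>2\<close>.\<close>
    have "norm (p + k) = norm (p * cnj (1 + k * p))"
      using pp by (simp add: distrib_left mult.left_commute[of p])
    also have "\<dots> = norm (1 + k * p)"
      by (simp only: norm_mult complex_mod_cnj p mult_1)
    finally have "(norm (1 + k * p))\<^sup>2 = norm ((1 + k * p) * (p + k))"
      by (simp add: norm_mult power2_eq_square)
    also have "\<dots> = c\<^sup>2"
      unfolding 2 using p by (simp add: norm_mult k_def norm_power)
    finally have "norm (1 + k * p) = c"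
      using c by simp
    moreover have "1 - k \<le> norm (1 + k * p)"
      using norm_diff_ineq[of 1 "k * p"] p k by (simp add: norm_mult)
    ultimately show False
      using k by simp
  qed
qed

text \<open>
  A zero at the smallest parameter \<open>c\<close> would be a limit of zero-free quadratics in \<open>w\<close>
  with constant term \<open>1 - c * z\<close> bounded away from zero, so it cannot have \<open>norm w < 1\<close>.
\<close>

lemma collision_nonzero_first:
  assumes c: "0 < c" "c < 1"
    and before: "\<And>c' v. 0 < c' \<Longrightarrow> c' < c \<Longrightarrow> norm v \<le> 1 \<Longrightarrow> collision c' v z \<noteq> 0"
    and w: "norm w < 1" and z: "norm z \<le> 1"
  shows "collision c w z \<noteq> 0"
proof -
  have bound: "(1 - c') * (1 - norm w)\<^sup>2 \<le> norm (collision c' w z)" if c': "0 < c'" "c' < c" for c'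
  proof -
    let ?a = "1 - c' * z"
    let ?b = "- c' * (1 - c' * z) + (1 - c' * z) * (c')\<^sup>2 * z + (c')\<^sup>2 * z :: complex"
    let ?d = "- c' * (1 - c' * z) * (c')\<^sup>2 * z :: complex"
    have quadratic: "collision c' v z = ?a + ?b * v + ?d * v\<^sup>2" for v
      by (simp add: collision_def algebra_simps power2_eq_square)
    have "1 - c' \<le> norm ?a"
      using norm_one_minus_ge[of z "of_real c'"] z c' by (simp add: mult.commute)
    then have "(1 - c') * (1 - norm w)\<^sup>2 \<le> norm ?a * (1 - norm w)\<^sup>2"
      by (simp add: mult_right_mono)
    also have "\<dots> \<le> norm (?a + ?b * w + ?d * w\<^sup>2)"
      using before[OF c'] w by (intro norm_quadratic_ge) (auto simp: quadratic)
    finally show ?thesis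
      by (simp only: quadratic)
  qed
  have "((\<lambda>c'. norm (collision c' w z) - (1 - c') * (1 - norm w)\<^sup>2) \<longlongrightarrow>
      norm (collision c w z) - (1 - c) * (1 - norm w)\<^sup>2) (at_left c)"
    unfolding collision_def by (intro tendsto_intros)
  moreover have "\<forall>\<^sub>F c' in at_left c. 0 \<le> norm (collision c' w z) - (1 - c') * (1 - norm w)\<^sup>2"
    using eventually_at_left_real[OF c(1)] by eventually_elim (use bound in auto)
  ultimately have "0 \<le> norm (collision c w z) - (1 - c) * (1 - norm w)\<^sup>2"
    by (rule tendsto_lowerbound) simp
  moreover have "0 < (1 - c) * (1 - norm w)\<^sup>2"
    using c w by simp
  ultimately show ?thesis
    by auto
qed

text \<open>Compactness gives a zero with least parameter. Applied in each variable,
  \<open>collision_nonzero_first\<close> pushes it onto the torus, where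
  \<open>collision_nonzero_torus\<close> excludes it.\<close>

lemma collision_nonzero:
  assumes c: "0 \<le> c" "c < c_star" and w: "norm w \<le> 1" and z: "norm z \<le> 1"
  shows "collision c w z \<noteq> 0"
proof
  assume zero: "collision c w z = 0"
  define S where "S = ({0..c} \<times> cball 0 1 \<times> cball 0 1) \<inter>
    {x :: real \<times> complex \<times> complex. collision (fst x) (fst (snd x)) (snd (snd x)) = 0}"
  have "compact S"
    unfolding S_def collision_def
    by (intro compact_Int_closed compact_Times compact_cball compact_Icc closed_Collect_eq
        continuous_intros)
  moreover have "(c, w, z) \<in> S"
    using zero c w z by (simp add: S_def)
  ultimately obtain x where x: "x \<in> S" "\<And>y. y \<in> S \<Longrightarrow> fst x \<le> fst y"
    using continuous_attains_inf[of S fst] continuous_on_fst[OF continuous_on_id] by blast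
  obtain c\<^sub>0 w\<^sub>0 z\<^sub>0 where x_eq: "x = (c\<^sub>0, w\<^sub>0, z\<^sub>0)"
    by (cases x)
  have c0: "0 \<le> c\<^sub>0" "c\<^sub>0 \<le> c" and le: "norm w\<^sub>0 \<le> 1" "norm z\<^sub>0 \<le> 1"
    and zero0: "collision c\<^sub>0 w\<^sub>0 z\<^sub>0 = 0"
    using x(1) by (auto simp: x_eq S_def)
  have before: "collision c' v u \<noteq> 0"
    if "0 < c'" "c' < c\<^sub>0" "norm v \<le> 1" "norm u \<le> 1" for c' v u
    using x(2)[of "(c', v, u)"] that c0 by (auto simp: x_eq S_def)
  have "c\<^sub>0 \<noteq> 0"
    using zero0 by (auto simp: collision_def)
  then have "0 < c\<^sub>0" "c\<^sub>0 < 1"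
    using c0 c c_star_less_one by auto
  then have "1 \<le> norm w\<^sub>0" "1 \<le> norm z\<^sub>0"
    using collision_nonzero_first[of c\<^sub>0 z\<^sub>0 w\<^sub>0] collision_nonzero_first[of c\<^sub>0 w\<^sub>0 z\<^sub>0]
      before le zero0 by (force simp: collision_commute[of _ z\<^sub>0 w\<^sub>0] not_less[symmetric])+
  then have "norm w\<^sub>0 = 1" "norm z\<^sub>0 = 1"
    using le by simp_all
  then show False
    using collision_nonzero_torus[of c\<^sub>0 w\<^sub>0 z\<^sub>0] c0 c zero0 by auto
qed

section \<open>Univalence\<close>

lemma phi_denominator_nonzero:
  fixes w :: complex
  assumes "0 \<le> c" "c < 1" "norm w \<le> 1"
  shows "1 - of_real c * w \<noteq> 0"
  using norm_one_minus_ge[of w "of_real c"] assms by (auto simp: mult.commute)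

lemma analytic_phi:
  assumes "w \<noteq> 0" "1 - of_real c * w \<noteq> 0"
  shows "phi c analytic_on {w}"
  unfolding phi_def using assms by (intro analytic_intros) auto

lemma meromorphic_phi: "phi c meromorphic_on A"
  unfolding phi_def by (intro meromorphic_intros)

lemma is_pole_phi: "is_pole (phi c) 0"
proof -
  have "filterlim (\<lambda>w::complex. 1 / w) at_infinity (at 0)"
    using is_pole_inverse[of 0] by (simp add: is_pole_def)
  moreover have "((\<lambda>w. - (of_real c / (1 - of_real c * w)) - (of_real c)\<^sup>2 * w) \<longlongrightarrow>
      - (of_real c / (1 - of_real c * 0)) - (of_real c)\<^sup>2 * 0) (at (0::complex))"
    by (intro tendsto_intros) simp
  ultimately have "filterlim (\<lambda>w. - (of_real c / (1 - of_real c * w)) - (of_real c)\<^sup>2 * w + 1 / w)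
      at_infinity (at (0::complex))"
    by (intro tendsto_add_filterlim_at_infinity)
  moreover have "(\<lambda>w. - (of_real c / (1 - of_real c * w)) - (of_real c)\<^sup>2 * w + 1 / w) = phi c"
    by (auto simp: phi_def)
  ultimately show ?thesis
    by (simp add: is_pole_def)
qed

lemma to_sphere_phi_zero: "to_sphere (phi c) 0 = sphere_infinity"
  by (simp add: to_sphere_def is_pole_phi)

lemma to_sphere_phi:
  assumes "w \<noteq> 0" "1 - of_real c * w \<noteq> 0"
  shows "to_sphere (phi c) w = Some (phi c w)"
  using analytic_phi[OF assms] by (simp add: to_sphere_def analytic_at_imp_no_pole)

lemma univalent_phi:
  assumes c: "0 \<le> c" "c < c_star"
  shows "univalent_on (phi c) (ball 0 1)"
proof -
  have denom: "1 - of_real c * w \<noteq> 0" if "norm w < 1" for w :: complex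
    using that c c_star_less_one by (intro phi_denominator_nonzero) auto
  have "inj_on (to_sphere (phi c)) (ball 0 1)"
  proof (rule inj_onI)
    fix w z :: complex
    assume wz: "w \<in> ball 0 1" "z \<in> ball 0 1" and eq: "to_sphere (phi c) w = to_sphere (phi c) z"
    then have norms: "norm w < 1" "norm z < 1"
      by auto
    show "w = z"
    proof (cases "w = 0 \<or> z = 0")
      case True
      then show ?thesis
        using eq norms denom
        by (metis option.distinct(1) to_sphere_phi to_sphere_phi_zero)
    next
      case False
      then have "phi c w - phi c z = 0"
        using eq norms denom by (simp add: to_sphere_phi)
      then have "(z - w) * collision c w z / (w * z * (1 - of_real c * w) * (1 - of_real c * z)) = 0"
        using False denom norms by (subst (asm) phi_diff) auto
      moreover have "collision c w z \<noteq> 0"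
        using norms c by (intro collision_nonzero) auto
      ultimately show ?thesis
        using False denom norms by simp
    qed
  qed
  then show ?thesis
    by (simp add: univalent_on_def meromorphic_phi)
qed

section \<open>Derivatives along the circle and signed curvature\<close>

text \<open>The first and second iterates of the operator \<open>w * d/dw\<close> applied to \<open>phi c\<close>.\<close>

definition log_deriv1 :: "real \<Rightarrow> complex \<Rightarrow> complex" where
  "log_deriv1 c w = - (1 / w) - (of_real c)\<^sup>2 * w - (of_real c)\<^sup>2 * w / (1 - of_real c * w)\<^sup>2"

definition log_deriv2 :: "real \<Rightarrow> complex \<Rightarrow> complex" where
  "log_deriv2 c w =
     1 / w - (of_real c)\<^sup>2 * w - (of_real c)\<^sup>2 * w * (1 + of_real c * w) / (1 - of_real c * w) ^ 3"

lemma phi_has_field_derivative: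
  assumes "w \<noteq> 0" "1 - of_real c * w \<noteq> 0"
  shows "(phi c has_field_derivative log_deriv1 c w / w) (at w)"
proof -
  let ?c = "of_real c :: complex"
  have inv: "((\<lambda>w. 1 / w) has_field_derivative - (1 / w\<^sup>2)) (at w)"
    using assms by (auto intro!: derivative_eq_intros simp: power2_eq_square)
  have frac: "((\<lambda>w. ?c / (1 - ?c * w)) has_field_derivative ?c\<^sup>2 / (1 - ?c * w)\<^sup>2) (at w)"
    using assms by (auto intro!: derivative_eq_intros simp: power2_eq_square)
  have "((\<lambda>w. 1 / w - ?c / (1 - ?c * w) - ?c\<^sup>2 * w) has_field_derivative
      - (1 / w\<^sup>2) - ?c\<^sup>2 / (1 - ?c * w)\<^sup>2 - ?c\<^sup>2) (at w)"
    by (intro DERIV_diff inv frac DERIV_cmult_Id)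
  also have "- (1 / w\<^sup>2) - ?c\<^sup>2 / (1 - ?c * w)\<^sup>2 - ?c\<^sup>2 = log_deriv1 c w / w"
    using assms by (simp add: log_deriv1_def diff_divide_distrib power2_eq_square)
  finally show ?thesis
    by (simp add: phi_def[abs_def])
qed

lemma log_deriv1_has_field_derivative:
  assumes "w \<noteq> 0" "1 - of_real c * w \<noteq> 0"
  shows "(log_deriv1 c has_field_derivative log_deriv2 c w / w) (at w)"
proof -
  let ?c = "of_real c :: complex"
  have inv: "((\<lambda>w. - (1 / w)) has_field_derivative 1 / w\<^sup>2) (at w)"
    using assms by (auto intro!: derivative_eq_intros simp: power2_eq_square)
  have "((\<lambda>w. ?c\<^sup>2 * w / (1 - ?c * w)\<^sup>2) has_field_derivative
      (?c\<^sup>2 * (1 - ?c * w)\<^sup>2 - ?c\<^sup>2 * w * (2 * (1 - ?c * w) * - ?c)) / ((1 - ?c * w)\<^sup>2 * (1 - ?c * w)\<^sup>2)) (at w)"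
    using assms by (auto intro!: derivative_eq_intros)
  \<comment> \<open>One factor \<open>1 - ?c * w\<close> is split off above and below, leaving the
    cube in the denominator.\<close>
  also have "?c\<^sup>2 * (1 - ?c * w)\<^sup>2 - ?c\<^sup>2 * w * (2 * (1 - ?c * w) * - ?c) =
      (1 - ?c * w) * (?c\<^sup>2 * (1 + ?c * w))"
    by (simp add: power2_eq_square algebra_simps)
  also have "(1 - ?c * w)\<^sup>2 * (1 - ?c * w)\<^sup>2 = (1 - ?c * w) * (1 - ?c * w) ^ 3"
    by (simp add: eval_nat_numeral mult_ac)
  finally have frac: "((\<lambda>w. ?c\<^sup>2 * w / (1 - ?c * w)\<^sup>2) has_field_derivative
      ?c\<^sup>2 * (1 + ?c * w) / (1 - ?c * w) ^ 3) (at w)"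
    using assms by simp
  have "((\<lambda>w. - (1 / w) - ?c\<^sup>2 * w - ?c\<^sup>2 * w / (1 - ?c * w)\<^sup>2) has_field_derivative
      1 / w\<^sup>2 - ?c\<^sup>2 - ?c\<^sup>2 * (1 + ?c * w) / (1 - ?c * w) ^ 3) (at w)"
    by (intro DERIV_diff inv frac DERIV_cmult_Id)
  also have "1 / w\<^sup>2 - ?c\<^sup>2 - ?c\<^sup>2 * (1 + ?c * w) / (1 - ?c * w) ^ 3 = log_deriv2 c w / w"
    using assms by (simp add: log_deriv2_def diff_divide_distrib power2_eq_square)
  finally show ?thesis
    by (simp add: log_deriv1_def[abs_def])
qed

text \<open>Along the circle, differentiation in the angle is i times the operator
  \<open>w * d/dw\<close>; dividing \<open>D\<close> by the point absorbs the chain rule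
  factor.\<close>

lemma has_vector_derivative_circle:
  assumes "(f has_field_derivative D / exp (\<i> * of_real t)) (at (exp (\<i> * of_real t)))"
  shows "((\<lambda>s. f (exp (\<i> * of_real s))) has_vector_derivative \<i> * D) (at t)"
proof -
  have "((\<lambda>s. exp (\<i> * of_real s)) has_vector_derivative \<i> * exp (\<i> * of_real t)) (at t)"
    by (rule has_vector_derivative_real_field) (auto intro!: derivative_eq_intros)
  from field_vector_diff_chain_at[OF this assms] show ?thesis
    by (simp add: o_def)
qed

text \<open>The velocity is i times \<open>log_deriv1\<close>, the acceleration is
  \<open>- log_deriv2\<close>, and the numerator of the curvature is
  \<open>Im (cnj v * a)\<close>.\<close>

lemma signed_curvature_boundary:
  assumes c: "0 \<le> c" "c < 1" and w: "w = exp (\<i> * of_real t)"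
  shows "signed_curvature (boundary_curve c) t =
    Re (cnj (log_deriv1 c w) * log_deriv2 c w) / norm (log_deriv1 c w) ^ 3"
proof -
  have denom: "1 - of_real c * exp (\<i> * of_real s) \<noteq> 0" for s
    using c by (intro phi_denominator_nonzero) auto
  have "(boundary_curve c has_vector_derivative \<i> * log_deriv1 c (exp (\<i> * of_real s))) (at s)" for s
    unfolding boundary_curve_def
    by (intro has_vector_derivative_circle phi_has_field_derivative denom) simp
  then have v: "vector_derivative (boundary_curve c) (at s) = \<i> * log_deriv1 c (exp (\<i> * of_real s))" for s
    by (rule vector_derivative_at)
  have "((\<lambda>s. \<i> * log_deriv1 c (exp (\<i> * of_real s))) has_vector_derivative
      \<i> * (\<i> * log_deriv2 c (exp (\<i> * of_real t)))) (at t)"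
    by (intro has_vector_derivative_mult_right has_vector_derivative_circle
        log_deriv1_has_field_derivative denom) simp
  then have a: "vector_derivative (\<lambda>s. vector_derivative (boundary_curve c) (at s)) (at t) =
      - log_deriv2 c w"
    unfolding v by (simp add: vector_derivative_at w)
  show ?thesis
    unfolding signed_curvature_def a by (simp add: v w norm_mult Let_def)
qed

section \<open>The curvature polynomial\<close>

text \<open>
  In terms of \<open>y = 2 - 2 * Re w\<close> on the unit circle, this is minus the numerator of
  \<open>Re (cnj (log_deriv1 c w) * log_deriv2 c w)\<close> over the denominator \<open>norm (1 - c * w) ^ 6\<close>.
\<close>

definition curvature_poly :: "'a::comm_ring_1 \<Rightarrow> 'a \<Rightarrow> 'a" where
  "curvature_poly c y = (let e = 1 + c\<^sup>2 in
     (1 - c\<^sup>2) * ((e - c) ^ 3 * (e - 3 * c) + 3 * c * (e - c) * (e\<^sup>2 - 3 * e * c + 4 * c\<^sup>2) * y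
       + 3 * c\<^sup>2 * (e\<^sup>2 - 4 * e * c + c\<^sup>2) * y\<^sup>2 + 2 * c ^ 3 * e * y ^ 3))"

text \<open>Here \<open>v\<close> stands for \<open>cnj w\<close>. The left side is symmetric in
  \<open>w\<close> and \<open>v\<close>, so with \<open>w * v = 1\<close> it reduces to a polynomial
  in \<open>w + v\<close>.\<close>

lemma curvature_poly_identity:
  fixes c w v :: "'a::field"
  assumes "w * v = 1"
  shows "((1 - c * v) ^ 3 * (w + c\<^sup>2 * v) + c\<^sup>2 * v * (1 - c * v)) *
      ((1 - c * w) ^ 3 * (v - c\<^sup>2 * w) - c\<^sup>2 * w * (1 + c * w)) +
      ((1 - c * w) ^ 3 * (v + c\<^sup>2 * w) + c\<^sup>2 * w * (1 - c * w)) *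
      ((1 - c * v) ^ 3 * (w - c\<^sup>2 * v) - c\<^sup>2 * v * (1 + c * v)) =
    2 * curvature_poly c (2 - w - v)"
proof -
  have w: "w \<noteq> 0"
    using assms by auto
  then have v: "v = 1 / w"
    using assms by (simp add: field_simps)
  define s where "s = w + v"
  define e where "e = 1 + c\<^sup>2"
  have s2: "w\<^sup>2 + v\<^sup>2 = s\<^sup>2 - 2"
    using assms by (simp add: s_def power2_eq_square algebra_simps)
  have s3: "w ^ 3 + v ^ 3 = s ^ 3 - 3 * s"
    using w by (simp add: s_def v field_simps power2_eq_square power3_eq_cube)
  have D: "(1 - c * w) * (1 - c * v) = e - c * s"
    using assms by (simp add: s_def e_def power2_eq_square algebra_simps)
  have T1: "(w + c\<^sup>2 * v) * (v - c\<^sup>2 * w) + (v + c\<^sup>2 * w) * (w - c\<^sup>2 * v) = 2 * (1 - c ^ 4)"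
    using w by (simp add: v field_simps eval_nat_numeral)
  have T2: "(1 - c * v) ^ 3 * (1 + c * w) * (w\<^sup>2 + c\<^sup>2) + (1 - c * w) ^ 3 * (1 + c * v) * (v\<^sup>2 + c\<^sup>2)
    = (1 - c\<^sup>2) ^ 3 * (w\<^sup>2 + v\<^sup>2) + (c - c ^ 5) * (w ^ 3 + v ^ 3) + (3 * c ^ 5 - 3 * c) * s
      + 8 * (c\<^sup>2 - c ^ 4)"
    using w by (simp add: v s_def field_simps eval_nat_numeral)
  have T3: "(1 - c * w)\<^sup>2 * (v\<^sup>2 - c\<^sup>2) + (1 - c * v)\<^sup>2 * (w\<^sup>2 - c\<^sup>2)
    = (1 - c ^ 4) * (w\<^sup>2 + v\<^sup>2) - 2 * c * (1 - c\<^sup>2) * s"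
    using w by (simp add: v s_def field_simps eval_nat_numeral)
  have T4: "(1 - c * v) * (1 + c * w) + (1 - c * w) * (1 + c * v) = 2 * (1 - c\<^sup>2)"
    using w by (simp add: v s_def field_simps eval_nat_numeral)
  have wX: "w * (w + c\<^sup>2 * v) = w\<^sup>2 + c\<^sup>2" "v * (v + c\<^sup>2 * w) = v\<^sup>2 + c\<^sup>2"
    and vY: "v * (v - c\<^sup>2 * w) = v\<^sup>2 - c\<^sup>2" "w * (w - c\<^sup>2 * v) = w\<^sup>2 - c\<^sup>2"
    using w by (simp_all add: v field_simps power2_eq_square)
  \<comment> \<open>The factors are kept opaque so that the brackets of the expansion are exactly
    the left sides of \<open>T1\<close> to \<open>T4\<close>.\<close>
  have expand: "(a ^ 3 * X + k * v * a) * (b ^ 3 * Y - k * w * q) + (b ^ 3 * X' + k * w * b) * (a ^ 3 * Y' - k * v * q')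
    = (b * a) ^ 3 * (X * Y + X' * Y') - k * (a ^ 3 * q * (w * X) + b ^ 3 * q' * (v * X'))
      + k * (b * a) * (b\<^sup>2 * (v * Y) + a\<^sup>2 * (w * Y')) - k\<^sup>2 * (w * v) * (a * q + b * q')"
    for a b k q q' X X' Y Y' :: 'a
    by (simp add: algebra_simps eval_nat_numeral)
  show ?thesis
    unfolding expand D T1 wX vY T2 T3 T4 assms s2 s3
    unfolding curvature_poly_def Let_def diff_diff_eq s_def[symmetric] e_def
    by (simp add: algebra_simps eval_nat_numeral)
qed

lemma Re_log_deriv_product:
  assumes c: "0 \<le> c" "c < 1" and w: "norm w = 1"
  shows "Re (cnj (log_deriv1 c w) * log_deriv2 c w) =
    - curvature_poly c (2 * (1 - Re w)) / norm (1 - of_real c * w) ^ 6"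
proof -
  define k where "k = complex_of_real c"
  define u where "u = 1 - k * w"
  define a where "a = u ^ 3 * (cnj w + k\<^sup>2 * w) + k\<^sup>2 * w * u"
  define b where "b = u ^ 3 * (cnj w - k\<^sup>2 * w) - k\<^sup>2 * w * (1 + k * w)"
  have u: "u \<noteq> 0"
    using phi_denominator_nonzero[of c w] c w by (simp add: u_def k_def)
  have ww: "w * cnj w = 1"
    using w by (simp flip: complex_norm_square)
  then have inv: "1 / w = cnj w"
    by (metis mult_zero_left nonzero_mult_div_cancel_left zero_neq_one)
  have a: "log_deriv1 c w = - a / u ^ 3"
    unfolding log_deriv1_def inv a_def using u
    by (simp add: u_def[symmetric] k_def[symmetric] field_simps eval_nat_numeral)
  have b: "log_deriv2 c w = b / u ^ 3"
    unfolding log_deriv2_def inv b_def using u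
    by (simp add: u_def[symmetric] k_def[symmetric] field_simps eval_nat_numeral)
  have u6: "cnj u ^ 3 * u ^ 3 = of_real (norm u ^ 6)"
  proof -
    have "cnj u ^ 3 * u ^ 3 = (u * cnj u) ^ 3"
      by (simp add: power_mult_distrib mult.commute)
    also have "\<dots> = of_real (((norm u)\<^sup>2) ^ 3)"
      by (simp only: complex_norm_square[symmetric] of_real_power)
    finally show ?thesis
      by (simp flip: power_mult)
  qed
  \<comment> \<open>Twice the real part, written as a sum of conjugates, has the shape of
    \<open>curvature_poly_identity\<close> with \<open>v = cnj w\<close>.\<close>
  have "cnj a * b + cnj (cnj a * b) = 2 * curvature_poly k (2 - w - cnj w)"
    unfolding curvature_poly_identity[OF ww, symmetric]
    by (simp add: a_def b_def u_def k_def)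
  also have "2 - w - cnj w = of_real (2 * (1 - Re w))"
    by (simp add: complex_eq_iff)
  also have "curvature_poly k (of_real (2 * (1 - Re w))) = of_real (curvature_poly c (2 * (1 - Re w)))"
    by (simp add: curvature_poly_def Let_def k_def)
  finally have "complex_of_real (2 * Re (cnj a * b)) = of_real (2 * curvature_poly c (2 * (1 - Re w)))"
    by (simp only: complex_add_cnj of_real_mult of_real_numeral)
  then have "Re (cnj a * b) = curvature_poly c (2 * (1 - Re w))"
    by (simp only: of_real_eq_iff)
  moreover have "cnj (log_deriv1 c w) * log_deriv2 c w = - (cnj a * b / of_real (norm u ^ 6))"
    unfolding a b u6[symmetric] by simp
  then have "Re (cnj (log_deriv1 c w) * log_deriv2 c w) = - (Re (cnj a * b) / norm u ^ 6)"
    by (simp only: uminus_complex.sel Re_divide_of_real)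
  ultimately show ?thesis
    by (simp add: u_def k_def)
qed

section \<open>Sign of the curvature and convexity\<close>

text \<open>The constant term is positive and the cubic term nonnegative. The quadratic coefficient
  may be negative, so it is offset by the linear term.\<close>

lemma curvature_poly_pos:
  fixes c y :: real
  assumes c: "0 \<le> c" "c < 1" "0 < 1 + c\<^sup>2 - 3 * c" and y: "0 \<le> y" "y \<le> 4"
  shows "0 < curvature_poly c y"
proof -
  define e where "e = 1 + c\<^sup>2"
  have e: "0 < e - 3 * c" "0 < e - c" "0 < e"
    using c unfolding e_def by (auto simp: add_pos_nonneg)
  have "0 \<le> e\<^sup>2 - 3 * e * c"
    using e by (simp add: power2_eq_square algebra_simps flip: right_diff_distrib)
  then have start: "0 \<le> (e - c) * (e\<^sup>2 - 3 * e * c + 4 * c\<^sup>2)"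
    using e by (intro mult_nonneg_nonneg) auto
  have finish: "0 \<le> e * (e - 3 * c) * (e + 3 * c)"
    using e c by simp
  \<comment> \<open>The linear and quadratic terms in \<open>y\<close> combine to \<open>3 * c * y\<close> times an affine function of \<open>y\<close>,
    written here as the interpolation of its values at \<open>0\<close> and \<open>4\<close>, both nonnegative.\<close>
  have "(1 - c\<^sup>2) * ((e - c) ^ 3 * (e - 3 * c) + 3 * c * y *
      ((1 - y / 4) * ((e - c) * (e\<^sup>2 - 3 * e * c + 4 * c\<^sup>2)) + y / 4 * (e * (e - 3 * c) * (e + 3 * c)))
      + 2 * c ^ 3 * e * y ^ 3) = curvature_poly c y"
    unfolding curvature_poly_def Let_def e_def[symmetric]
    by (simp add: field_simps eval_nat_numeral)
  moreover have "0 < 1 - c\<^sup>2"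
    using c by (simp add: power_less_one_iff)
  moreover have "0 < (e - c) ^ 3 * (e - 3 * c)"
    using e by simp
  moreover have "0 \<le> 3 * c * y *
      ((1 - y / 4) * ((e - c) * (e\<^sup>2 - 3 * e * c + 4 * c\<^sup>2)) + y / 4 * (e * (e - 3 * c) * (e + 3 * c)))"
    by (intro mult_nonneg_nonneg[OF _ add_nonneg_nonneg] mult_nonneg_nonneg[OF _ start]
        mult_nonneg_nonneg[OF _ finish]) (use c y in auto)
  moreover have "0 \<le> 2 * c ^ 3 * e * y ^ 3"
    using c y e by simp
  ultimately show ?thesis
    by (metis add_pos_nonneg mult_pos_pos)
qed

lemma curvature_poly_at_0:
  "curvature_poly c 0 = (1 - c\<^sup>2) * ((1 + c\<^sup>2 - c) ^ 3 * (1 + c\<^sup>2 - 3 * c))"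
  by (simp add: curvature_poly_def Let_def)

text \<open>This is the point \<open>w = -1\<close>. Since \<open>phi (-c) (-w) = - phi c w\<close>,
  the value is that at \<open>y = 0\<close> with \<open>-c\<close> in place of
  \<open>c\<close>.\<close>

lemma curvature_poly_at_4:
  "curvature_poly c 4 = (1 - c\<^sup>2) * ((1 + c\<^sup>2 + c) ^ 3 * (1 + c\<^sup>2 + 3 * c))"
proof -
  have "(e - c) ^ 3 * (e - 3 * c) + 3 * c * (e - c) * (e\<^sup>2 - 3 * e * c + 4 * c\<^sup>2) * 4
      + 3 * c\<^sup>2 * (e\<^sup>2 - 4 * e * c + c\<^sup>2) * 4\<^sup>2 + 2 * c ^ 3 * e * 4 ^ 3 = (e + c) ^ 3 * (e + 3 * c)" for e
    by (simp add: algebra_simps eval_nat_numeral)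
  then show ?thesis
    by (simp add: curvature_poly_def Let_def)
qed

lemma signed_curvature_neg_iff:
  assumes c: "0 \<le> c" "c < 1"
  shows "signed_curvature (boundary_curve c) t < 0 \<longleftrightarrow> 0 < curvature_poly c (2 * (1 - cos t))"
proof -
  define w where "w = exp (\<i> * of_real t)"
  have w: "norm w = 1" "Re w = cos t"
    by (simp_all add: w_def flip: cis_conv_exp)
  have "0 < norm (1 - of_real c * w) ^ 6"
    using phi_denominator_nonzero[of c w] c w by simp
  then have Re_neg: "Re (cnj (log_deriv1 c w) * log_deriv2 c w) < 0 \<longleftrightarrow>
      0 < curvature_poly c (2 * (1 - cos t))"
    unfolding Re_log_deriv_product[OF c w(1)] w(2) by (auto simp: field_simps)
  have "signed_curvature (boundary_curve c) t < 0 \<longleftrightarrow>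
      Re (cnj (log_deriv1 c w) * log_deriv2 c w) < 0"
    unfolding signed_curvature_boundary[OF c w_def]
    \<comment> \<open>Where the velocity vanishes, the curvature is 0 by convention and the real
      part is 0 too, so both sides are false.\<close>
    by (cases "log_deriv1 c w = 0") (auto simp: divide_less_0_iff)
  with Re_neg show ?thesis
    by simp
qed

text \<open>The curvature is negative at angle \<open>pi\<close> for all these \<open>c\<close>, so
  convexity forces it to be negative at angle 0 as well, which is the condition
  \<open>c < c_one\<close>. Conversely, \<open>curvature_poly_pos\<close> covers every
  angle.\<close>

lemma convex_boundary_iff:
  assumes c: "0 \<le> c" "c < 1"
  shows "convex_curve (boundary_curve c) \<longleftrightarrow> c < c_one"
proof
  assume convex: "convex_curve (boundary_curve c)"
  have "0 < 1 - c\<^sup>2"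
    using c by (simp add: power_less_one_iff)
  moreover have "0 < 1 + c\<^sup>2 + c" "0 < 1 + c\<^sup>2 + 3 * c" "0 < 1 + c\<^sup>2 - c"
    using c add_less_le_mono[of c 1 0 "c\<^sup>2"] by (simp_all add: add_pos_nonneg)
  ultimately have "signed_curvature (boundary_curve c) pi < 0"
    and "signed_curvature (boundary_curve c) 0 < 0 \<longleftrightarrow> 0 < 1 + c\<^sup>2 - 3 * c"
    using c by (simp_all add: signed_curvature_neg_iff curvature_poly_at_0 curvature_poly_at_4
        zero_less_mult_iff)
  then show "c < c_one"
    using convex c unfolding convex_curve_def c_one_iff[OF c] by (meson less_asym)
next
  assume "c < c_one"
  then have poly_pos: "0 < 1 + c\<^sup>2 - 3 * c"
    using c by (simp add: c_one_iff)
  have "0 < curvature_poly c (2 * (1 - cos t))" for t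
  proof -
    have "0 \<le> 2 * (1 - cos t)" "2 * (1 - cos t) \<le> 4"
      using cos_ge_minus_one[of t] cos_le_one[of t] by argo+
    then show ?thesis
      using c poly_pos by (intro curvature_poly_pos)
  qed
  then show "convex_curve (boundary_curve c)"
    using c by (simp add: convex_curve_def signed_curvature_neg_iff)
qed

lemma c_one_less_one: "c_one < 1"
  by (simp add: c_one_def)

theorem proposition3p1:
  shows "(\<forall>c::real. 0 \<le> c \<and> c < c_star \<longrightarrow>
            univalent_on (phi c) (ball 0 1) \<and> to_sphere (phi c) 0 = sphere_infinity)
       \<and> (\<forall>c::real. 0 \<le> c \<and> c < c_one \<longrightarrow> convex_curve (boundary_curve c))
       \<and> (\<forall>c::real. 0 \<le> c \<and> c < c_star \<and> convex_curve (boundary_curve c) \<longrightarrow> c < c_one)"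
  using univalent_phi to_sphere_phi_zero convex_boundary_iff
    less_trans[OF _ c_star_less_one] less_trans[OF _ c_one_less_one] by blast

end
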